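(* Let $\mathcal{T}\subset I\times J\times I\times J$ be a finite set of Wang tiles having horizontal and vertical stripes, with associated partition $\mathcal{T}=\mathcal{T}_{00}\cup\mathcal{T}_{01}\cup\mathcal{T}_{10}\cup\mathcal{T}_{11}$. Suppose that $\mathcal{T}$ determines the quadrilateral $ABDC$ for some $A,B,C,D\in\mathbb{R}^2$. If the equation $$\begin{pmatrix}0\\0\end{pmatrix}=(1-x)\big((1-y)A+yB\big)+x\big((1-y)C+yD\big)\qquad( * )$$ has finitely many solutions $(x,y)\in\mathbb{R}^2$, then for every valid configuration $w:\mathbb{Z}^2\to\mathcal{T}$, the density $\alpha$ of tiles with vertical stripes (tiles in $\mathcal{T}_{01}\cup\mathcal{T}_{11}$) and the density $\beta$ of tiles with horizontal stripes (tiles in $\mathcal{T}_{10}\cup\mathcal{T}_{11}$) both exist, and $(x,y)=(\alpha,\beta)$ is a solution of $( * )$.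
   Context: Wang tiles. Let $I$ (vertical colors) and $J$ (horizontal colors) be finite sets. A Wang tile is a tuple $\tau=(a,b,c,d)\in I\times J\times I\times J$, where $a,b,c,d$ are the labels of the right (east), top (north), left (west) and bottom (south) edges of a unit square. For a finite set $\mathcal{T}$ of Wang tiles, a configuration $w:\mathbb{Z}^2\to\mathcal{T}$ is valid if for all $n\in\mathbb{Z}^2$ the east label of $w_n$ equals the west label of $w_{n+(1,0)}$ and the north label of $w_n$ equals the south label of $w_{n+(0,1)}$. Stripes. $\mathcal{T}$ has horizontal and vertical stripes if there are partitions $I=I_0\sqcup I_1$ and $J=J_0\sqcup J_1$ such that every $(a,b,c,d)\in\mathcal{T}$ has $a,c$ in the same part of $I$ and $b,d$ in the same part of $J$. Then $\mathcal{T}_{xy}=\mathcal{T}\cap(I_x\times J_y\times I_x\times J_y)$ for $x,y\in\{0,1\}$ ($x=1$: horizontal stripe present; $y=1$: vertical stripe present). Quadrilateral. $\mathcal{T}$ determines the quadrilateral $ABDC$ ($A,B,C,D\in\mathbb{R}^2$, possibly degenerate) if there are maps $v:I\to\mathbb{R}^2$ and $h:J\to\mathbb{R}^2$ such that for every $\tau=(a,b,c,d)\in\mathcal{T}$, the vector $v(a)+h(b)-v(c)-h(d)$ equals $A$ if $\tau\in\mathcal{T}_{00}$, $B$ if $\tau\in\mathcal{T}_{10}$, $C$ if $\tau\in\mathcal{T}_{01}$, and $D$ if $\tau\in\mathcal{T}_{11}$. Density. The density of $\mathcal{S}\subset\mathcal{T}$ in $w$ is $\lim_{K\to\infty}\#\{n\in\mathbb{Z}^2\cap[-K,K]^2: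 w_n\in\mathcal{S}\}/(2K+1)^2$, when this limit exists. *)

theory Defs
  imports "HOL-Analysis.Analysis"
begin

(* A tile (a, b, c, d) lists the east, north, west and south labels, in this order. *)
type_synonym ('i, 'j) wang_tile = "'i \<times> 'j \<times> 'i \<times> 'j"

fun east :: "('i, 'j) wang_tile \<Rightarrow> 'i" where "east (a, b, c, d) = a"
fun north :: "('i, 'j) wang_tile \<Rightarrow> 'j" where "north (a, b, c, d) = b"
fun west :: "('i, 'j) wang_tile \<Rightarrow> 'i" where "west (a, b, c, d) = c"
fun south :: "('i, 'j) wang_tile \<Rightarrow> 'j" where "south (a, b, c, d) = d"

definition valid_configuration ::
    "('i, 'j) wang_tile set \<Rightarrow> (int \<times> int \<Rightarrow> ('i, 'j) wang_tile) \<Rightarrow> bool" where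
  "valid_configuration T w \<longleftrightarrow>
     (\<forall>n. w n \<in> T) \<and>
     (\<forall>n. east (w n) = west (w (n + (1, 0)))) \<and>
     (\<forall>n. north (w n) = south (w (n + (0, 1))))"

(* The parts of a partition are allowed to be empty. *)
definition has_stripes ::
    "'i set \<Rightarrow> 'j set \<Rightarrow> 'i set \<Rightarrow> 'i set \<Rightarrow> 'j set \<Rightarrow> 'j set \<Rightarrow> ('i, 'j) wang_tile set \<Rightarrow> bool" where
  "has_stripes I J I0 I1 J0 J1 T \<longleftrightarrow>
     I = I0 \<union> I1 \<and> I0 \<inter> I1 = {} \<and> J = J0 \<union> J1 \<and> J0 \<inter> J1 = {} \<and>
     (\<forall>(a, b, c, d) \<in> T.
        (a \<in> I0 \<and> c \<in> I0 \<or> a \<in> I1 \<and> c \<in> I1) \<and>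
        (b \<in> J0 \<and> d \<in> J0 \<or> b \<in> J1 \<and> d \<in> J1))"

(* With P = I_x and Q = J_y this is the class T_xy. *)
definition tile_class ::
    "('i, 'j) wang_tile set \<Rightarrow> 'i set \<Rightarrow> 'j set \<Rightarrow> ('i, 'j) wang_tile set" where
  "tile_class T P Q = T \<inter> (P \<times> Q \<times> P \<times> Q)"

(* The corners are passed in the cyclic order A, B, D, C, as in the name ABDC. *)
definition determines_quadrilateral ::
    "'i set \<Rightarrow> 'i set \<Rightarrow> 'j set \<Rightarrow> 'j set \<Rightarrow> ('i, 'j) wang_tile set \<Rightarrow>
     real^2 \<Rightarrow> real^2 \<Rightarrow> real^2 \<Rightarrow> real^2 \<Rightarrow> bool" where
  "determines_quadrilateral I0 I1 J0 J1 T A B D C \<longleftrightarrow>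
     (\<exists>(v :: 'i \<Rightarrow> real^2) (h :: 'j \<Rightarrow> real^2). \<forall>(a, b, c, d) \<in> T.
        ((a, b, c, d) \<in> tile_class T I0 J0 \<longrightarrow> v a + h b - v c - h d = A) \<and>
        ((a, b, c, d) \<in> tile_class T I1 J0 \<longrightarrow> v a + h b - v c - h d = B) \<and>
        ((a, b, c, d) \<in> tile_class T I0 J1 \<longrightarrow> v a + h b - v c - h d = C) \<and>
        ((a, b, c, d) \<in> tile_class T I1 J1 \<longrightarrow> v a + h b - v c - h d = D))"

definition has_density ::
    "(int \<times> int \<Rightarrow> ('i, 'j) wang_tile) \<Rightarrow> ('i, 'j) wang_tile set \<Rightarrow> real \<Rightarrow> bool" where
  "has_density w S \<delta> \<longleftrightarrow>
     (\<lambda>K::nat. real (card {n \<in> {- int K..int K} \<times> {- int K..int K}. w n \<in> S})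
                 / (2 * real K + 1)\<^sup>2) \<longlonglongrightarrow> \<delta>"

definition solves_bilinear ::
    "real^2 \<Rightarrow> real^2 \<Rightarrow> real^2 \<Rightarrow> real^2 \<Rightarrow> real \<Rightarrow> real \<Rightarrow> bool" where
  "solves_bilinear A B D C x y \<longleftrightarrow>
     0 = (1 - x) *\<^sub>R ((1 - y) *\<^sub>R A + y *\<^sub>R B) + x *\<^sub>R ((1 - y) *\<^sub>R C + y *\<^sub>R D)"

end

theory Submission
  imports Defs "HOL-Real_Asymp.Real_Asymp"
begin

text \<open>
  Whether a tile of a valid configuration has a vertical stripe depends only on its column, and
  whether it has a horizontal stripe only on its row. If \<open>\<alpha>\<close>, \<open>\<beta>\<close> are the frequencies of such columns
  and rows in a window of side \<open>N\<close>, then summing \<open>v a + h b - v c - h d\<close> over the window gives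
  \<open>N\<^sup>2\<close> times the right-hand side of the bilinear equation at \<open>(\<alpha>, \<beta>)\<close>. The same sum telescopes to a
  boundary term of size \<open>O(N)\<close>, so every limit point of the pairs \<open>(\<alpha>, \<beta>)\<close> is a solution. Enlarging
  the window by one step moves the pair by \<open>O(1 / N)\<close>, and a sequence with vanishing steps in a
  compact set cannot move between finitely many limit points, so the pairs converge.
\<close>

section \<open>Convergence of slowly varying sequences in a compact set\<close>

text \<open>On a nonempty compact \<open>S\<close> the norm of \<open>F\<close> attains a minimum,
  which is positive because \<open>F\<close> has no zero there; values tending to 0 eventually drop
  below it.\<close>

lemma compact_eventually_notin_if_no_zero:
  fixes F :: "'a::topological_space \<Rightarrow> 'b::real_normed_vector"
  assumes "compact S" "continuous_on S F" "\<And>x. x \<in> S \<Longrightarrow> F x \<noteq> 0"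
    and "((\<lambda>n. F (X n)) \<longlongrightarrow> 0) G"
  shows "eventually (\<lambda>n. X n \<notin> S) G"
proof (cases "S = {}")
  case False
  obtain z where z: "z \<in> S" "\<And>x. x \<in> S \<Longrightarrow> norm (F z) \<le> norm (F x)"
    using continuous_attains_inf[OF assms(1) False continuous_on_norm[OF assms(2)]] by blast
  then have "norm (F z) > 0"
    using assms(3) by simp
  then have "eventually (\<lambda>n. dist (F (X n)) 0 < norm (F z)) G"
    using assms(4) by (rule tendstoD[rotated])
  then show ?thesis
    by eventually_elim (use z(2) in fastforce)
qed auto

text \<open>Limit points of \<open>X\<close> are zeros of \<open>F\<close>, and these are isolated.
  A zero-free shell around one of them is eventually avoided by \<open>X\<close>, and steps shorter
  than its thickness cannot jump across it, so \<open>X\<close> stays trapped inside.\<close>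

lemma slowly_varying_convergent_to_zero:
  fixes X :: "nat \<Rightarrow> 'a::metric_space" and F :: "'a \<Rightarrow> 'b::real_normed_vector"
  assumes S: "compact S" "\<And>n. X n \<in> S"
    and F: "continuous_on S F" "(\<lambda>n. F (X n)) \<longlonglongrightarrow> 0" "finite {x \<in> S. F x = 0}"
    and step: "(\<lambda>n. dist (X n) (X (Suc n))) \<longlonglongrightarrow> 0"
  obtains l where "l \<in> S" "F l = 0" "X \<longlonglongrightarrow> l"
proof -
  obtain l r where l: "l \<in> S" and r: "strict_mono r" "(X \<circ> r) \<longlonglongrightarrow> l"
    using S by (metis compact_eq_seq_compact_metric seq_compact_def)
  have "(\<lambda>n. F ((X \<circ> r) n)) \<longlonglongrightarrow> F l"
    by (rule continuous_on_tendsto_compose[OF F(1) r(2) l]) (simp add: S(2))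
  moreover have "(\<lambda>n. F ((X \<circ> r) n)) \<longlonglongrightarrow> 0"
    using LIMSEQ_subseq_LIMSEQ[OF F(2) r(1)] by (simp add: o_def)
  ultimately have Fl: "F l = 0"
    by (rule LIMSEQ_unique)
  obtain \<rho> where \<rho>: "\<rho> > 0" "\<And>x. x \<in> S \<Longrightarrow> F x = 0 \<Longrightarrow> x \<noteq> l \<Longrightarrow> \<rho> \<le> dist l x"
    using finite_set_avoid[OF F(3), of l] by auto
  have "X \<longlonglongrightarrow> l"
  proof (rule tendstoI)
    fix e :: real
    assume "e > 0"
    \<comment> \<open>The factor 1/3 keeps the ball of radius \<open>2 * \<epsilon>\<close> around
      \<open>l\<close> clear of every other zero.\<close>
    define \<epsilon> where "\<epsilon> = min e (\<rho> / 3)"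
    have \<epsilon>: "\<epsilon> > 0" "\<epsilon> \<le> e" "2 * \<epsilon> < \<rho>"
      using \<open>e > 0\<close> \<rho>(1) by (auto simp: \<epsilon>_def)
    \<comment> \<open>A closed shell of thickness \<open>\<epsilon>\<close>: its inner radius
      excludes \<open>l\<close>, its outer radius the remaining zeros.\<close>
    define K where "K = S \<inter> {x. \<epsilon> \<le> dist l x \<and> dist l x \<le> 2 * \<epsilon>}"
    have "closed {x. \<epsilon> \<le> dist l x \<and> dist l x \<le> 2 * \<epsilon>}"
      by (intro closed_Collect_conj closed_Collect_le continuous_intros)
    then have "compact K"
      unfolding K_def using S(1) by blast
    moreover have "F x \<noteq> 0" if "x \<in> K" for x
      using \<rho>(2)[of x] that \<epsilon> by (cases "x = l") (auto simp: K_def)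
    ultimately have "eventually (\<lambda>n. X n \<notin> K) sequentially"
      using F(2) by (intro compact_eventually_notin_if_no_zero[where F = F])
        (auto simp: K_def intro: continuous_on_subset[OF F(1)])
    moreover have "eventually (\<lambda>n. dist (dist (X n) (X (Suc n))) 0 < \<epsilon>) sequentially"
      using step \<epsilon>(1) by (rule tendstoD)
    ultimately have "eventually (\<lambda>n. X n \<notin> K \<and> dist (X n) (X (Suc n)) < \<epsilon>) sequentially"
      by eventually_elim auto
    then obtain n0 where n0: "\<And>n. n \<ge> n0 \<Longrightarrow> X n \<notin> K \<and> dist (X n) (X (Suc n)) < \<epsilon>"
      unfolding eventually_sequentially by blast
    obtain k0 where "\<And>k. k \<ge> k0 \<Longrightarrow> dist (X (r k)) l < \<epsilon>"
      using tendstoD[OF r(2) \<epsilon>(1)] by (auto simp: eventually_sequentially)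
    \<comment> \<open>Since \<open>r k \<ge> k\<close>, the index \<open>r (max k0 n0)\<close> is
      late enough for both conditions.\<close>
    then obtain m where m: "m \<ge> n0" "dist (X m) l < \<epsilon>"
      using seq_suble[OF r(1), of "max k0 n0"] by (metis max.bounded_iff order_refl)
    have "dist (X n) l < \<epsilon>" if "n \<ge> m" for n
      using that
    proof (induction n rule: dec_induct)
      case (step n)
      \<comment> \<open>From inside the inner radius one step reaches distance below
        \<open>2 * \<epsilon>\<close>; as it cannot land in the shell, it remains within
        \<open>\<epsilon>\<close>.\<close>
      have "dist (X (Suc n)) l \<le> dist (X n) (X (Suc n)) + dist (X n) l"
        by (metis dist_commute dist_triangle)
      moreover have "dist (X n) (X (Suc n)) < \<epsilon>" "X (Suc n) \<notin> K"
        using n0[of n] n0[of "Suc n"] step m(1) by auto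
      ultimately show ?case
        using step.IH S(2)[of "Suc n"] by (auto simp: K_def dist_commute)
    qed (use m in auto)
    then show "eventually (\<lambda>n. dist (X n) l < e) sequentially"
      unfolding eventually_sequentially using \<epsilon>(2) by (meson order_less_le_trans)
  qed
  with l Fl show ?thesis
    using that by blast
qed

section \<open>Frequencies in centred windows\<close>

definition window :: "nat \<Rightarrow> int set" where
  "window K = {- int K..int K}"

text \<open>One-dimensional frequencies suffice, because each kind of stripe depends on a single
  coordinate.\<close>

definition window_freq :: "int set \<Rightarrow> nat \<Rightarrow> real" where
  "window_freq P K = real (card (window K \<inter> P)) / (2 * real K + 1)"

lemma finite_window [simp]: "finite (window K)"
  by (simp add: window_def)

lemma card_window: "real (card (window K)) = 2 * real K + 1"
  by (simp add: window_def)

lemma card_window_Int_le: "real (card (window K \<inter> P)) \<le> 2 * real K + 1"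
  using card_mono[of "window K" "window K \<inter> P"] by (simp flip: card_window)

lemma window_freq_in_unit: "window_freq P K \<in> {0..1}"
  using card_window_Int_le[of K P] by (simp add: window_freq_def)

text \<open>The larger window has two new integers, so the numerator grows by at most 2 and the
  denominator by exactly 2.\<close>

lemma window_freq_step: "\<bar>window_freq P (Suc K) - window_freq P K\<bar> \<le> 2 / (2 * real K + 3)"
proof -
  define s where "s = real (card (window K \<inter> P))"
  define s' where "s' = real (card (window (Suc K) \<inter> P))"
  have "card (window K \<inter> P) \<le> card (window (Suc K) \<inter> P)"
    by (intro card_mono) (auto simp: window_def)
  then have "s \<le> s'"
    by (simp add: s_def s'_def)
  have "card (window (Suc K) \<inter> P) \<le> card ((window K \<inter> P) \<union> {- int (Suc K), int (Suc K)})"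
    by (intro card_mono) (auto simp: window_def)
  also have "\<dots> \<le> card (window K \<inter> P) + 2"
    by (rule order_trans[OF card_Un_le]) simp
  finally have "s' \<le> s + 2"
    by (simp add: s_def s'_def)
  have "0 \<le> s" "s \<le> 2 * real K + 1"
    using card_window_Int_le by (auto simp: s_def)
  \<comment> \<open>Both terms of the difference in the numerator lie between 0 and 2.\<close>
  have eq: "window_freq P (Suc K) - window_freq P K
      = ((s' - s) - 2 * (s / (2 * real K + 1))) / (2 * real K + 3)"
    unfolding window_freq_def s_def[symmetric] s'_def[symmetric]
    by (simp add: divide_simps) (simp add: algebra_simps)
  have "0 \<le> s / (2 * real K + 1)" "s / (2 * real K + 1) \<le> 1"
    using \<open>0 \<le> s\<close> \<open>s \<le> 2 * real K + 1\<close> by auto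
  then have "\<bar>(s' - s) - 2 * (s / (2 * real K + 1))\<bar> \<le> 2"
    using \<open>s \<le> s'\<close> \<open>s' \<le> s + 2\<close> by linarith
  then show ?thesis
    unfolding eq by (simp add: abs_divide divide_right_mono)
qed

lemma window_freq_step_tendsto_0:
  "(\<lambda>K. \<bar>window_freq P (Suc K) - window_freq P K\<bar>) \<longlonglongrightarrow> 0"
proof (rule tendsto_sandwich[OF _ _ tendsto_const])
  show "(\<lambda>K. 2 / (2 * real K + 3)) \<longlonglongrightarrow> 0"
    by real_asymp
qed (auto simp: window_freq_step)

text \<open>The summand is \<open>z\<close> on \<open>P\<close> and \<open>u\<close> off it; the
  affine form allows use in each argument of \<open>bilinear_map\<close>.\<close>

lemma sum_window_affine:
  fixes u z :: "'a::real_vector"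
  shows "(\<Sum>i\<in>window K. (1 - indicator P i) *\<^sub>R u + indicator P i *\<^sub>R z)
    = (2 * real K + 1) *\<^sub>R ((1 - window_freq P K) *\<^sub>R u + window_freq P K *\<^sub>R z)"
proof -
  have "(\<Sum>i\<in>window K. indicator P i) = (2 * real K + 1) * window_freq P K"
    by (simp add: window_freq_def sum.If_cases indicator_def)
  then show ?thesis
    by (simp add: sum.distrib flip: scaleR_sum_left)
      (simp add: sum_subtractf card_window algebra_simps)
qed

section \<open>Averages of the bilinear expression\<close>

text \<open>At (0,0), (0,1), (1,0), (1,1) the values are \<open>A\<close>, \<open>B\<close>,
  \<open>C\<close>, \<open>D\<close>: the first argument stands for vertical stripes, the second for
  horizontal ones.\<close>

definition bilinear_map :: "'a::real_vector \<Rightarrow> 'a \<Rightarrow> 'a \<Rightarrow> 'a \<Rightarrow> real \<Rightarrow> real \<Rightarrow> 'a" where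
  "bilinear_map A B D C x y
    = (1 - x) *\<^sub>R ((1 - y) *\<^sub>R A + y *\<^sub>R B) + x *\<^sub>R ((1 - y) *\<^sub>R C + y *\<^sub>R D)"

lemma bilinear_map_swap: "bilinear_map A B D C x y = bilinear_map A C D B y x"
  by (simp add: bilinear_map_def algebra_simps)

text \<open>Being affine in each argument separately, the map commutes with averaging over
  \<open>i\<close> and over \<open>j\<close>.\<close>

lemma sum_window_bilinear_map:
  "(\<Sum>i\<in>window K. \<Sum>j\<in>window K. bilinear_map A B D C (indicator P i) (indicator Q j))
    = (2 * real K + 1)\<^sup>2 *\<^sub>R bilinear_map A B D C (window_freq P K) (window_freq Q K)"
proof -
  have "(\<Sum>j\<in>window K. bilinear_map A B D C x (indicator Q j))
      = (2 * real K + 1) *\<^sub>R bilinear_map A B D C x (window_freq Q K)" for x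
    \<comment> \<open>Exchanging the arguments brings the summed one into the outer affine
      position.\<close>
    unfolding bilinear_map_swap[of A B D C] by (simp add: bilinear_map_def sum_window_affine)
  then show ?thesis
    by (simp add: scaleR_sum_right[symmetric] power2_eq_square)
      (simp add: bilinear_map_def sum_window_affine)
qed

section \<open>Telescoping sums over windows\<close>

lemma sum_window_telescope:
  fixes f :: "int \<Rightarrow> 'a::ab_group_add"
  shows "(\<Sum>x\<in>window K. f (x + 1) - f x) = f (int K + 1) - f (- int K)"
proof (induction K)
  case (Suc K)
  have "window (Suc K) = insert (- int (Suc K)) (insert (int (Suc K)) (window K))"
    by (auto simp: window_def)
  moreover have "- int (Suc K) \<notin> insert (int (Suc K)) (window K)" "int (Suc K) \<notin> window K"
    by (auto simp: window_def)
  ultimately show ?case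
    using Suc by (simp add: algebra_simps)
qed (simp add: window_def)

text \<open>Each of the \<open>2 * K + 1\<close> lines leaves only its two end values, so the bound
  is linear in the side of the window.\<close>

lemma norm_sum_window_telescope_le:
  fixes f :: "int \<Rightarrow> int \<Rightarrow> 'a::real_normed_vector"
  assumes "\<And>x y. norm (f x y) \<le> M"
  shows "norm (\<Sum>y\<in>window K. \<Sum>x\<in>window K. f (x + 1) y - f x y) \<le> (2 * real K + 1) * (2 * M)"
proof -
  have "norm (f (int K + 1) y - f (- int K) y) \<le> 2 * M" for y
    using norm_triangle_ineq4[of "f (int K + 1) y" "f (- int K) y"] assms[of "int K + 1" y]
      assms[of "- int K" y] by linarith
  then have "norm (\<Sum>y\<in>window K. f (int K + 1) y - f (- int K) y) \<le> (\<Sum>y\<in>window K. 2 * M)"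
    by (intro sum_norm_le)
  then show ?thesis
    by (simp add: sum_window_telescope[where f = "\<lambda>x. f x _"] card_window)
qed

section \<open>Stripes in a valid configuration\<close>

lemma int_shift_invariant:
  fixes R :: "int \<Rightarrow> bool"
  assumes "\<And>x. R (x + 1) \<longleftrightarrow> R x"
  shows "R x \<longleftrightarrow> R 0"
proof (induction x rule: int_induct[where k = 0])
  case (step2 i)
  then show ?case
    using assms[of "i - 1"] by simp
qed (use assms in auto)

lemma has_stripes_west_iff_east:
  assumes "has_stripes I J I0 I1 J0 J1 T" "t \<in> T"
  shows "west t \<in> I1 \<longleftrightarrow> east t \<in> I1"
  using assms by (cases t) (fastforce simp: has_stripes_def)

lemma has_stripes_south_iff_north:
  assumes "has_stripes I J I0 I1 J0 J1 T" "t \<in> T"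
  shows "south t \<in> J1 \<longleftrightarrow> north t \<in> J1"
  using assms by (cases t) (fastforce simp: has_stripes_def)

lemma has_stripes_tile_class:
  assumes "has_stripes I J I0 I1 J0 J1 T" "t \<in> T"
  shows "t \<in> tile_class T (if west t \<in> I1 then I1 else I0) (if south t \<in> J1 then J1 else J0)"
  using assms by (cases t) (fastforce simp: has_stripes_def tile_class_def)

lemma vertical_stripe_iff:
  assumes "has_stripes I J I0 I1 J0 J1 T"
  shows "t \<in> tile_class T I0 J1 \<union> tile_class T I1 J1 \<longleftrightarrow> t \<in> T \<and> south t \<in> J1"
  using assms by (cases t) (fastforce simp: has_stripes_def tile_class_def)

lemma horizontal_stripe_iff:
  assumes "has_stripes I J I0 I1 J0 J1 T"
  shows "t \<in> tile_class T I1 J0 \<union> tile_class T I1 J1 \<longleftrightarrow> t \<in> T \<and> west t \<in> I1"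
  using assms by (cases t) (fastforce simp: has_stripes_def tile_class_def)

text \<open>Horizontal neighbours share a label, and within a tile the west and east labels lie in
  the same part.\<close>

lemma row_stripe_constant:
  assumes "has_stripes I J I0 I1 J0 J1 T" "valid_configuration T w"
  shows "west (w (x, y)) \<in> I1 \<longleftrightarrow> west (w (0, y)) \<in> I1"
proof (rule int_shift_invariant)
  fix x
  have "west (w (x + 1, y)) = east (w (x, y))" "w (x, y) \<in> T"
    using assms(2) by (auto simp: valid_configuration_def)
  then show "west (w (x + 1, y)) \<in> I1 \<longleftrightarrow> west (w (x, y)) \<in> I1"
    using has_stripes_west_iff_east[OF assms(1)] by metis
qed

lemma column_stripe_constant:
  assumes "has_stripes I J I0 I1 J0 J1 T" "valid_configuration T w"
  shows "south (w (x, y)) \<in> J1 \<longleftrightarrow> south (w (x, 0)) \<in> J1"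
proof (rule int_shift_invariant)
  fix y
  have "south (w (x, y + 1)) = north (w (x, y))" "w (x, y) \<in> T"
    using assms(2) by (auto simp: valid_configuration_def)
  then show "south (w (x, y + 1)) \<in> J1 \<longleftrightarrow> south (w (x, y)) \<in> J1"
    using has_stripes_south_iff_north[OF assms(1)] by metis
qed

section \<open>Densities of sets of full columns or rows\<close>

text \<open>The counted cells form a product set, so the proportion equals
  \<open>window_freq P K\<close> exactly for every \<open>K\<close>.\<close>

lemma has_density_columns:
  assumes "window_freq P \<longlonglongrightarrow> \<delta>" "\<And>x y. w (x, y) \<in> S \<longleftrightarrow> x \<in> P"
  shows "has_density w S \<delta>"
proof -
  have "{n \<in> window K \<times> window K. w n \<in> S} = (window K \<inter> P) \<times> window K" for K
    using assms(2) by auto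
  then have "real (card {n \<in> window K \<times> window K. w n \<in> S}) / (2 * real K + 1)\<^sup>2
      = window_freq P K" for K
    by (simp add: card_cartesian_product card_window window_freq_def power2_eq_square)
  with assms(1) show ?thesis
    by (simp add: has_density_def flip: window_def)
qed

lemma has_density_rows:
  assumes "window_freq Q \<longlonglongrightarrow> \<delta>" "\<And>x y. w (x, y) \<in> S \<longleftrightarrow> y \<in> Q"
  shows "has_density w S \<delta>"
proof -
  have "{n \<in> window K \<times> window K. w n \<in> S} = window K \<times> (window K \<inter> Q)" for K
    using assms(2) by auto
  then have "real (card {n \<in> window K \<times> window K. w n \<in> S}) / (2 * real K + 1)\<^sup>2
      = window_freq Q K" for K
    by (simp add: card_cartesian_product card_window window_freq_def power2_eq_square)
  with assms(1) show ?thesis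
    by (simp add: has_density_def flip: window_def)
qed

section \<open>Boundary estimate and existence of the densities\<close>

lemma bilinear_map_window_freq_tendsto_0:
  fixes A B C D :: "real^2"
  assumes "finite I" "finite J" "T \<subseteq> I \<times> J \<times> I \<times> J"
    and stripes: "has_stripes I J I0 I1 J0 J1 T"
    and quad: "determines_quadrilateral I0 I1 J0 J1 T A B D C"
    and valid: "valid_configuration T w"
  defines "P \<equiv> {x. south (w (x, 0)) \<in> J1}" and "Q \<equiv> {y. west (w (0, y)) \<in> I1}"
  shows "(\<lambda>K. bilinear_map A B D C (window_freq P K) (window_freq Q K)) \<longlonglongrightarrow> 0"
proof -
  have inT: "w n \<in> T" for n
    using valid unfolding valid_configuration_def by blast
  obtain v :: "'a \<Rightarrow> real^2" and h :: "'b \<Rightarrow> real^2" where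
    vh: "\<forall>(a, b, c, d) \<in> T.
        ((a, b, c, d) \<in> tile_class T I0 J0 \<longrightarrow> v a + h b - v c - h d = A) \<and>
        ((a, b, c, d) \<in> tile_class T I1 J0 \<longrightarrow> v a + h b - v c - h d = B) \<and>
        ((a, b, c, d) \<in> tile_class T I0 J1 \<longrightarrow> v a + h b - v c - h d = C) \<and>
        ((a, b, c, d) \<in> tile_class T I1 J1 \<longrightarrow> v a + h b - v c - h d = D)"
    using quad unfolding determines_quadrilateral_def by blast
  have tile: "v (east t) + h (north t) - v (west t) - h (south t)
      = bilinear_map A B D C (of_bool (south t \<in> J1)) (of_bool (west t \<in> I1))" if "t \<in> T" for t
    using bspec[OF vh that] has_stripes_tile_class[OF stripes that]
    by (cases t) (auto simp: bilinear_map_def split: if_splits)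
  obtain Mv where Mv: "\<And>i. i \<in> I \<Longrightarrow> norm (v i) \<le> Mv"
    using finite_imp_bounded[OF finite_imageI[OF assms(1), of v]] by (auto simp: bounded_iff)
  obtain Mh where Mh: "\<And>j. j \<in> J \<Longrightarrow> norm (h j) \<le> Mh"
    using finite_imp_bounded[OF finite_imageI[OF assms(2), of h]] by (auto simp: bounded_iff)
  define f where "f x y = v (west (w (x, y)))" for x y
  \<comment> \<open>The vertical coordinate comes first, so that
    \<open>norm_sum_window_telescope_le\<close> applies to \<open>g\<close> as it does to
    \<open>f\<close>.\<close>
  define g where "g y x = h (south (w (x, y)))" for x y
  have "west t \<in> I" "south t \<in> J" if "t \<in> T" for t
    using assms(3) that by (cases t; auto)+
  then have fM: "norm (f x y) \<le> Mv" and gM: "norm (g y x) \<le> Mh" for x y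
    using Mv Mh inT by (auto simp: f_def g_def)
  have tile_w: "(f (x + 1) y - f x y) + (g (y + 1) x - g y x)
      = bilinear_map A B D C (indicator P x) (indicator Q y)" for x y
  proof -
    \<comment> \<open>Edge matching turns east and north labels into west and south labels of the
      neighbours, making the tile relation a sum of differences.\<close>
    have "f (x + 1) y = v (east (w (x, y)))" "g (y + 1) x = h (north (w (x, y)))"
      using valid by (auto simp: f_def g_def valid_configuration_def)
    then have "(f (x + 1) y - f x y) + (g (y + 1) x - g y x)
        = v (east (w (x, y))) + h (north (w (x, y))) - v (west (w (x, y))) - h (south (w (x, y)))"
      by (simp add: f_def g_def)
    also have "\<dots> = bilinear_map A B D C (indicator P x) (indicator Q y)"
      using column_stripe_constant[OF stripes valid, of x y]
        row_stripe_constant[OF stripes valid, of x y]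
      by (simp add: tile[OF inT] P_def Q_def indicator_def)
    finally show ?thesis .
  qed
  have bound: "norm (bilinear_map A B D C (window_freq P K) (window_freq Q K))
      \<le> (2 * Mv + 2 * Mh) / (2 * real K + 1)" for K
  proof -
    let ?N = "2 * real K + 1"
    have "?N\<^sup>2 *\<^sub>R bilinear_map A B D C (window_freq P K) (window_freq Q K)
        = (\<Sum>x\<in>window K. \<Sum>y\<in>window K. (f (x + 1) y - f x y) + (g (y + 1) x - g y x))"
      by (simp add: sum_window_bilinear_map[symmetric] tile_w)
    also have "\<dots> = (\<Sum>y\<in>window K. \<Sum>x\<in>window K. f (x + 1) y - f x y)
        + (\<Sum>x\<in>window K. \<Sum>y\<in>window K. g (y + 1) x - g y x)"
      unfolding sum.distrib
      \<comment> \<open>Only the first double sum is swapped: \<open>f\<close> telescopes along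
        \<open>x\<close>, while \<open>g\<close> already has \<open>y\<close> innermost.\<close>
      by (rule arg_cong[where f = "\<lambda>s. s + _"], rule sum.swap)
    finally have "norm (?N\<^sup>2 *\<^sub>R bilinear_map A B D C (window_freq P K) (window_freq Q K))
        \<le> ?N * (2 * Mv) + ?N * (2 * Mh)"
      using norm_triangle_mono[OF norm_sum_window_telescope_le[of f, OF fM]
          norm_sum_window_telescope_le[of g, OF gM]] by (simp only:)
    \<comment> \<open>One factor \<open>?N\<close> cancels, leaving a bound of order
      \<open>1 / ?N\<close>.\<close>
    then have "?N * (?N * norm (bilinear_map A B D C (window_freq P K) (window_freq Q K)))
        \<le> ?N * (2 * Mv + 2 * Mh)"
      unfolding norm_scaleR abs_power2 distrib_left[of ?N "2 * Mv"]
      by (simp only: power2_eq_square mult.assoc)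
    then have "?N * norm (bilinear_map A B D C (window_freq P K) (window_freq Q K))
        \<le> 2 * Mv + 2 * Mh"
      by (rule mult_left_le_imp_le) simp
    then show ?thesis
      by (simp add: pos_le_divide_eq mult.commute)
  qed
  have "(\<lambda>K. (2 * Mv + 2 * Mh) / (2 * real K + 1)) \<longlonglongrightarrow> 0"
    by real_asymp
  then show ?thesis
    by (rule Lim_null_comparison[OF always_eventually[OF allI[OF bound]]])
qed

theorem proposition7p1:
  fixes I I0 I1 :: "'i set" and J J0 J1 :: "'j set"
    and T :: "('i, 'j) wang_tile set"
    and A B C D :: "real^2"
  assumes "finite I" and "finite J"
    and "T \<subseteq> I \<times> J \<times> I \<times> J"
    and "has_stripes I J I0 I1 J0 J1 T"
    and "determines_quadrilateral I0 I1 J0 J1 T A B D C"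
    and "finite {(x, y). solves_bilinear A B D C x y}"
  shows "\<forall>w. valid_configuration T w \<longrightarrow>
    (\<exists>\<alpha> \<beta>. has_density w (tile_class T I0 J1 \<union> tile_class T I1 J1) \<alpha> \<and>
           has_density w (tile_class T I1 J0 \<union> tile_class T I1 J1) \<beta> \<and>
           solves_bilinear A B D C \<alpha> \<beta>)"
proof (intro allI impI)
  fix w
  assume valid: "valid_configuration T w"
  define P where "P = {x. south (w (x, 0)) \<in> J1}"
  define Q where "Q = {y. west (w (0, y)) \<in> I1}"
  define F where "F z = bilinear_map A B D C (fst z) (snd z)" for z
  have solves_iff: "solves_bilinear A B D C x y \<longleftrightarrow> F (x, y) = 0" for x y
    by (auto simp: solves_bilinear_def F_def bilinear_map_def)
  let ?X = "\<lambda>K. (window_freq P K, window_freq Q K)"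
  have "compact ({0..1::real} \<times> {0..1::real})"
    by (intro compact_Times compact_Icc)
  moreover have "?X K \<in> {0..1} \<times> {0..1}" for K
    using window_freq_in_unit by simp
  moreover have "continuous_on ({0..1} \<times> {0..1}) F"
    unfolding F_def bilinear_map_def by (intro continuous_intros)
  moreover have "(\<lambda>K. F (?X K)) \<longlonglongrightarrow> 0"
    using bilinear_map_window_freq_tendsto_0[OF assms(1-5) valid] by (simp add: F_def P_def Q_def)
  \<comment> \<open>Zeros in the unit square are among the finitely many real solutions.\<close>
  moreover have "finite {z \<in> {0..1} \<times> {0..1}. F z = 0}"
    by (rule finite_subset[OF _ assms(6)]) (auto simp: solves_iff)
  moreover have "(\<lambda>K. dist (?X K) (?X (Suc K))) \<longlonglongrightarrow> 0"
  proof -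
    have "(\<lambda>K. sqrt (\<bar>window_freq P (Suc K) - window_freq P K\<bar>\<^sup>2
        + \<bar>window_freq Q (Suc K) - window_freq Q K\<bar>\<^sup>2)) \<longlonglongrightarrow> sqrt (0\<^sup>2 + 0\<^sup>2)"
      by (intro tendsto_intros window_freq_step_tendsto_0)
    then show ?thesis
      by (simp add: dist_Pair_Pair dist_real_def power2_commute)
  qed
  ultimately obtain l where l: "F l = 0" "?X \<longlonglongrightarrow> l"
    by (rule slowly_varying_convergent_to_zero)
  have P: "window_freq P \<longlonglongrightarrow> fst l" and Q: "window_freq Q \<longlonglongrightarrow> snd l"
    using tendsto_fst[OF l(2)] tendsto_snd[OF l(2)] by auto
  have inT: "w n \<in> T" for n
    using valid unfolding valid_configuration_def by blast
  have "has_density w (tile_class T I0 J1 \<union> tile_class T I1 J1) (fst l)"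
    by (rule has_density_columns[OF P], subst vertical_stripe_iff[OF assms(4)])
      (use inT column_stripe_constant[OF assms(4) valid] in \<open>auto simp: P_def\<close>)
  moreover have "has_density w (tile_class T I1 J0 \<union> tile_class T I1 J1) (snd l)"
    by (rule has_density_rows[OF Q], subst horizontal_stripe_iff[OF assms(4)])
      (use inT row_stripe_constant[OF assms(4) valid] in \<open>auto simp: Q_def\<close>)
  moreover have "solves_bilinear A B D C (fst l) (snd l)"
    using l(1) by (simp add: solves_iff)
  ultimately show "\<exists>\<alpha> \<beta>. has_density w (tile_class T I0 J1 \<union> tile_class T I1 J1) \<alpha> \<and>
      has_density w (tile_class T I1 J0 \<union> tile_class T I1 J1) \<beta> \<and> solves_bilinear A B D C \<alpha> \<beta>"
    by blast
qed

end
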